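(* For every integer $k\ge2$, the formal power series $$D_k(x,q_2,q_3,q_4):=\sum_{n\ge1}x^n\sum_{w\in\mathcal F_{n,k}}q_2^{\deg_2(G(w))}q_3^{\deg_3(G(w))}q_4^{\deg_4(G(w))}$$ is equal to $$\frac{q_2^4\left((q_3^2q_4+q_4)x-(q_3^2q_4^2-2q_2q_3^2q_4^2+q_3^4q_4)x^2-q_3^{2k}q_4^kx^k+(q_3^{2k+2}q_4^k-2q_2q_3^{2k}q_4^{k+1})x^{k+1}\right)}{q_4\left(1-(q_3^2+q_4q_3^2)x+(q_4q_3^4-q_2^2q_4^2q_3^2)x^2+q_2^2q_4^{k+1}q_3^{2k}x^{k+1}\right)}.$$
   Context: For integers $k\ge 2$, $n\ge1$, $\mathcal F_{n,k}$ is the set of binary words $w=w_1\cdots w_n$ with no $k$ consecutive $1$'s. $P(w)$ is the bargraph polyomino formed by the unit squares $[i-1,i]\times[j-1,j]$, $1\le i\le n$, $1\le j\le w_i+1$. $G(w)$ is the graph whose vertices are the corners of the cells of $P(w)$ and whose edges are the cell sides (unit segments that are a side of at least one cell). For a graph $G$, $\deg_i(G)$ is the number of vertices of $G$ of degree $i$ (every vertex of $G(w)$ has degree $2$, $3$ or $4$). *)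

theory Defs
  imports
    "HOL-Library.Sublist"
    "HOL-Computational_Algebra.Computational_Algebra"
begin

definition fib_words :: "nat \<Rightarrow> nat \<Rightarrow> nat list set" where
  "fib_words n k =
     {w. length w = n \<and> set w \<subseteq> {0, 1} \<and> \<not> sublist (replicate k 1) w}"

text \<open>A cell is represented by its lower left corner, so the pair \<open>(i, j)\<close> stands for the unit
  square \<open>[i, i+1] \<times> [j, j+1]\<close>; columns and rows are counted from 0, as are the letters of \<open>w\<close>.\<close>

definition bargraph_cells :: "nat list \<Rightarrow> (nat \<times> nat) set" where
  "bargraph_cells w = {(i, j). i < length w \<and> j < w ! i + 1}"

fun cell_corners :: "nat \<times> nat \<Rightarrow> (nat \<times> nat) set" where
  "cell_corners (i, j) = {(i, j), (i + 1, j), (i, j + 1), (i + 1, j + 1)}"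

text \<open>A unit segment is represented by the set of its two end points.\<close>

fun cell_sides :: "nat \<times> nat \<Rightarrow> (nat \<times> nat) set set" where
  "cell_sides (i, j) =
     {{(i, j), (i + 1, j)}, {(i, j + 1), (i + 1, j + 1)},
      {(i, j), (i, j + 1)}, {(i + 1, j), (i + 1, j + 1)}}"

type_synonym 'a ugraph = "'a set \<times> 'a set set"

definition bargraph_graph :: "nat list \<Rightarrow> (nat \<times> nat) ugraph" where
  "bargraph_graph w =
     (\<Union>c\<in>bargraph_cells w. cell_corners c, \<Union>c\<in>bargraph_cells w. cell_sides c)"

definition vertex_degree :: "'a ugraph \<Rightarrow> 'a \<Rightarrow> nat" where
  "vertex_degree G v = card {e \<in> snd G. v \<in> e}"

definition num_deg :: "nat \<Rightarrow> 'a ugraph \<Rightarrow> nat" where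
  "num_deg i G = card {v \<in> fst G. vertex_degree G v = i}"

text \<open>The field of fractions of \<open>\<int>[q\<^sub>2][q\<^sub>3][q\<^sub>4]\<close>, with its three indeterminates. The identity is
  stated in the ring of formal power series in \<open>x\<close> over this field: \<open>q\<^sub>4\<close> occurs as a factor of
  the denominator and is not invertible in the polynomial ring.\<close>

type_synonym ratfun3 = "int poly poly poly fract"

definition q2 :: ratfun3 where "q2 = Fraction_Field.Fract [:[:[:0, 1:]:]:] 1"
definition q3 :: ratfun3 where "q3 = Fraction_Field.Fract [:[:0, 1:]:] 1"
definition q4 :: ratfun3 where "q4 = Fraction_Field.Fract [:0, 1:] 1"

definition D :: "nat \<Rightarrow> ratfun3 fps" where
  "D k = Abs_fps (\<lambda>n. if n \<ge> 1 then
     (\<Sum>w\<in>fib_words n k. q2 ^ num_deg 2 (bargraph_graph w)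
        * q3 ^ num_deg 3 (bargraph_graph w) * q4 ^ num_deg 4 (bargraph_graph w))
     else 0)"

end

theory Submission
  imports Defs
begin

text \<open>
  The vertices of the bargraph graph lie on vertical grid lines, and the degrees on a line depend
  only on the heights of the two columns adjacent to it. Hence the degree monomial of \<open>w\<close> is a
  product over consecutive letters: \<open>00\<close> contributes \<open>q\<^sub>3\<^sup>2\<close>, \<open>11\<close> contributes \<open>q\<^sub>3\<^sup>2 q\<^sub>4\<close>, \<open>01\<close> and
  \<open>10\<close> contribute \<open>q\<^sub>2 q\<^sub>3 q\<^sub>4\<close>, and an end letter 0 or 1 contributes \<open>q\<^sub>2\<^sup>2\<close> or \<open>q\<^sub>2\<^sup>2 q\<^sub>3\<close>.
  Let \<open>Z\<close> and \<open>Y\<close> be the generating functions of the words starting with 0 and 1, without the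
  factor of the left end. Removing the first letter gives, with \<open>s = q\<^sub>2 q\<^sub>3 q\<^sub>4\<close> and \<open>t = q\<^sub>3\<^sup>2 q\<^sub>4\<close>,
  \<open>Z = x (q\<^sub>2\<^sup>2 + q\<^sub>3\<^sup>2 Z + s Y)\<close> and
  \<open>Y = x (q\<^sub>2\<^sup>2 q\<^sub>3 + s Z + t Y) - t\<^bsup>k-1\<^esup> x\<^sup>k (q\<^sub>2\<^sup>2 q\<^sub>3 + s Z)\<close>, where the last term removes the words
  that acquire a run of \<open>k\<close> ones. Solving this linear system gives the formula.
\<close>

section \<open>Degrees of the graph along a vertical grid line\<close>

definition column_height :: "nat list \<Rightarrow> nat \<Rightarrow> nat" where
  "column_height w i = (if i < length w then w ! i + 1 else 0)"

text \<open>The leftmost line has no column on its left, whereas truncated subtraction in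
  \<open>column_height w (i - 1)\<close> would return the first column there.\<close>

definition left_height :: "nat list \<Rightarrow> nat \<Rightarrow> nat" where
  "left_height w i = (case i of 0 \<Rightarrow> 0 | Suc m \<Rightarrow> column_height w m)"

text \<open>On a vertical grid line with columns of heights \<open>a\<close> and \<open>b\<close> on its two sides (0 if there is
  no column), the four summands count the edges from height \<open>j\<close> going up, down, left and right.\<close>

definition line_degree :: "nat \<Rightarrow> nat \<Rightarrow> nat \<Rightarrow> nat" where
  "line_degree a b j = of_bool (j < max a b) + of_bool (0 < j \<and> j \<le> max a b)
     + of_bool (0 < a \<and> j \<le> a) + of_bool (0 < b \<and> j \<le> b)"

definition line_weight :: "(nat \<Rightarrow> 'a::comm_ring_1) \<Rightarrow> nat \<Rightarrow> nat \<Rightarrow> 'a" where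
  "line_weight f a b = (\<Prod>j\<le>max a b. f (line_degree a b j))"

lemma mem_bargraph_cells_iff: "(i, j) \<in> bargraph_cells w \<longleftrightarrow> j < column_height w i"
  by (auto simp: bargraph_cells_def column_height_def)

text \<open>The empty word is excluded because its graph has no vertices, while the right-hand side
  would still contain \<open>(0, 0)\<close>.\<close>

lemma bargraph_vertices:
  assumes "w \<noteq> []"
  shows "fst (bargraph_graph w) =
    (SIGMA i:{..length w}. {..max (left_height w i) (column_height w i)})" (is "?V = ?S")
proof (intro set_eqI iffI)
  fix v assume "v \<in> ?V"
  then show "v \<in> ?S"
    by (fastforce simp: bargraph_graph_def bargraph_cells_def left_height_def column_height_def
        split: nat.split if_splits)
next
  fix v assume "v \<in> ?S"
  then obtain i j where v: "v = (i, j)" "i \<le> length w"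
    and j: "j \<le> max (left_height w i) (column_height w i)" by auto
  have *: "(a, b) \<in> ?V" if "(c, d) \<in> bargraph_cells w" "(a, b) \<in> cell_corners (c, d)" for a b c d
    using that by (force simp: bargraph_graph_def)
  \<comment> \<open>For positive \<open>j\<close> the point is a corner of the cell just below it,
    for \<open>j = 0\<close> of the bottom cell of the column.\<close>
  have right: "(i, j) \<in> ?V" if "j \<le> column_height w i" "0 < column_height w i"
    using that *[of i j i j] *[of i "j - 1" i j]
    by (cases j) (auto simp: mem_bargraph_cells_iff)
  have left: "(i, j) \<in> ?V" if "i = Suc m" "j \<le> column_height w m" "0 < column_height w m" for m
    using that *[of m j i j] *[of m "j - 1" i j]
    by (cases j) (auto simp: mem_bargraph_cells_iff)
  have "0 < column_height w i \<or> (\<exists>m. i = Suc m \<and> 0 < column_height w m)"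
    using v assms by (cases i) (auto simp: column_height_def)
  then have "(i, j) \<in> ?V"
  proof
    assume "0 < column_height w i"
    then show ?thesis using j left right
      by (cases "left_height w i = 0")
        (auto simp: left_height_def le_max_iff_disj split: nat.splits)
  next
    assume "\<exists>m. i = Suc m \<and> 0 < column_height w m"
    then show ?thesis using j left right
      by (cases "column_height w i = 0") (auto simp: left_height_def le_max_iff_disj)
  qed
  then show "v \<in> ?V" using v by simp
qed

text \<open>Such a segment is a left side of a cell in column \<open>i\<close> or a right side of
  one in the preceding column.\<close>

lemma vertical_edge_iff:
  "{(i, j), (i, Suc j)} \<in> snd (bargraph_graph w) \<longleftrightarrow>
     j < max (left_height w i) (column_height w i)"
proof -
  have "{(i, j), (i, Suc j)} \<in> snd (bargraph_graph w) \<longleftrightarrow>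
     (i, j) \<in> bargraph_cells w \<or> (\<exists>m. i = Suc m \<and> (m, j) \<in> bargraph_cells w)"
    by (force simp: bargraph_graph_def doubleton_eq_iff)
  then show ?thesis
    by (cases i) (auto simp: mem_bargraph_cells_iff left_height_def)
qed

text \<open>Such a segment is the bottom of the cell above it or the top of the cell below it.
  Positivity of the height matters at \<open>j = 0\<close>, where an absent column gives no
  edge.\<close>

lemma horizontal_edge_iff:
  "{(i, j), (Suc i, j)} \<in> snd (bargraph_graph w) \<longleftrightarrow>
     0 < column_height w i \<and> j \<le> column_height w i"
proof -
  have "{(i, j), (Suc i, j)} \<in> snd (bargraph_graph w) \<longleftrightarrow>
     (i, j) \<in> bargraph_cells w \<or> (\<exists>m. j = Suc m \<and> (i, m) \<in> bargraph_cells w)"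
    by (force simp: bargraph_graph_def doubleton_eq_iff)
  then show ?thesis
    by (cases j) (auto simp: mem_bargraph_cells_iff)
qed

lemma edge_cases:
  assumes "e \<in> snd (bargraph_graph w)"
  obtains i j where "e = {(i, j), (i, Suc j)}" | i j where "e = {(i, j), (Suc i, j)}"
  using assms by (auto simp: bargraph_graph_def)

text \<open>Reduces counting edges at a vertex to counting its neighbours.\<close>

lemma incident_edges:
  "{e \<in> snd (bargraph_graph w). (i, j) \<in> e} =
     (\<lambda>u. {(i, j), u}) ` {u. {(i, j), u} \<in> snd (bargraph_graph w)}"
proof (intro set_eqI iffI)
  fix e assume e: "e \<in> {e \<in> snd (bargraph_graph w). (i, j) \<in> e}"
  then obtain u where "e = {(i, j), u}"
    by (auto elim!: edge_cases simp: insert_commute)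
  with e show "e \<in> (\<lambda>u. {(i, j), u}) ` {u. {(i, j), u} \<in> snd (bargraph_graph w)}"
    by auto
qed auto

lemma neighbours:
  "{u. {(i, j), u} \<in> snd (bargraph_graph w)} =
     {u. u = (i, Suc j) \<and> j < max (left_height w i) (column_height w i)} \<union>
     {u. u = (i, j - 1) \<and> 0 < j \<and> j \<le> max (left_height w i) (column_height w i)} \<union>
     {u. u = (i - 1, j) \<and> 0 < left_height w i \<and> j \<le> left_height w i} \<union>
     {u. u = (Suc i, j) \<and> 0 < column_height w i \<and> j \<le> column_height w i}" (is "?N = ?R")
proof (intro set_eqI iffI)
  fix u assume "u \<in> ?N"
  then have e: "{(i, j), u} \<in> snd (bargraph_graph w)" by simp
  then show "u \<in> ?R"
  proof (cases rule: edge_cases)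
    case (1 a b)
    with e vertical_edge_iff[of a b w] show ?thesis by (auto simp: doubleton_eq_iff)
  next
    case (2 a b)
    with e horizontal_edge_iff[of a b w] show ?thesis
      by (auto simp: doubleton_eq_iff left_height_def)
  qed
next
  fix u assume "u \<in> ?R"
  then show "u \<in> ?N"
    using vertical_edge_iff[of i j w] vertical_edge_iff[of i "j - 1" w]
      horizontal_edge_iff[of i j w] horizontal_edge_iff[of "i - 1" j w]
    by (cases i) (auto simp: insert_commute left_height_def)
qed

lemma vertex_degree_bargraph:
  "vertex_degree (bargraph_graph w) (i, j) =
     line_degree (left_height w i) (column_height w i) j"
proof -
  let ?N = "{u. {(i, j), u} \<in> snd (bargraph_graph w)}"
  have "inj_on (\<lambda>u. {(i, j), u}) ?N"
    by (auto simp: inj_on_def doubleton_eq_iff)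
  then have "vertex_degree (bargraph_graph w) (i, j) = card ?N"
    by (simp add: vertex_degree_def incident_edges card_image)
  also have "\<dots> = line_degree (left_height w i) (column_height w i) j"
  proof -
    have card_if: "card {u. u = x \<and> P} = of_bool P" for x :: "nat \<times> nat" and P
      by (cases P) auto
    have "0 < left_height w i \<Longrightarrow> 0 < i"
      by (cases i) (auto simp: left_height_def)
    \<comment> \<open>The four sets are pairwise disjoint with at most one element each, so the
      cardinality is a sum of four indicators.\<close>
    then show ?thesis
      unfolding neighbours line_degree_def
      by (subst card_Un_disjoint, simp, simp, fastforce)+ (simp add: card_if)
  qed
  finally show ?thesis .
qed

section \<open>The degree monomial as a product over grid lines\<close>

lemma prod_vertex_degree_eq:
  fixes f :: "nat \<Rightarrow> 'a::comm_ring_1"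
  assumes "w \<noteq> []"
  shows "(\<Prod>v\<in>fst (bargraph_graph w). f (vertex_degree (bargraph_graph w) v)) =
    (\<Prod>i\<le>length w. line_weight f (left_height w i) (column_height w i))"
proof -
  have "(\<Prod>v\<in>fst (bargraph_graph w). f (vertex_degree (bargraph_graph w) v)) =
    (\<Prod>(i, j)\<in>fst (bargraph_graph w). f (line_degree (left_height w i) (column_height w i) j))"
    by (intro prod.cong) (auto simp: vertex_degree_bargraph)
  then show ?thesis
    by (simp add: bargraph_vertices[OF assms] prod.Sigma line_weight_def)
qed

text \<open>Encoding the three counts in one vertex weight lets a single product over vertices
  produce the whole monomial.\<close>

definition degree_weight :: "'a \<Rightarrow> 'a \<Rightarrow> 'a \<Rightarrow> nat \<Rightarrow> 'a::comm_ring_1" where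
  "degree_weight a b c d = (if d = 2 then a else if d = 3 then b else if d = 4 then c else 1)"

lemma prod_degree_weight:
  fixes a b c :: "'a::comm_ring_1"
  assumes "finite (fst G)"
  shows "(\<Prod>v\<in>fst G. degree_weight a b c (vertex_degree G v)) =
    a ^ num_deg 2 G * b ^ num_deg 3 G * c ^ num_deg 4 G"
proof -
  have *: "x ^ num_deg d G = (\<Prod>v\<in>fst G. if vertex_degree G v = d then x else 1)" for x :: 'a and d
    using assms by (simp add: num_deg_def prod.If_cases Int_def)
  show ?thesis
    unfolding * prod.distrib[symmetric]
    by (intro prod.cong) (auto simp: degree_weight_def)
qed

text \<open>The leftmost line is left out, so prepending a letter adds exactly one factor. The right
  end is included, since the height at \<open>length w\<close> is 0.\<close>

definition chain_weight :: "(nat \<Rightarrow> 'a::comm_ring_1) \<Rightarrow> nat list \<Rightarrow> 'a" where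
  "chain_weight f w = (\<Prod>i<length w. line_weight f (column_height w i) (column_height w (Suc i)))"

lemma column_height_Cons_Suc [simp]: "column_height (a # w) (Suc i) = column_height w i"
  by (simp add: column_height_def)

lemma column_height_Cons_0 [simp]: "column_height (a # w) 0 = Suc a"
  by (simp add: column_height_def)

lemma column_height_Nil [simp]: "column_height [] i = 0"
  by (simp add: column_height_def)

lemma chain_weight_Nil [simp]: "chain_weight f [] = 1"
  by (simp add: chain_weight_def)

lemma chain_weight_Cons:
  "chain_weight f (a # w) = line_weight f (Suc a) (column_height w 0) * chain_weight f w"
  by (simp add: chain_weight_def prod.lessThan_Suc_shift del: prod.lessThan_Suc)

lemma degree_monomial_eq:
  assumes "w \<noteq> []"
  shows "a ^ num_deg 2 (bargraph_graph w) * b ^ num_deg 3 (bargraph_graph w)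
      * c ^ num_deg 4 (bargraph_graph w) =
    line_weight (degree_weight a b c) 0 (column_height w 0) * chain_weight (degree_weight a b c) w"
proof -
  have "finite (fst (bargraph_graph w))"
    by (simp add: bargraph_vertices[OF assms])
  from prod_degree_weight[OF this, of a b c] show ?thesis
    using prod_vertex_degree_eq[OF assms, of "degree_weight a b c"]
    by (simp add: chain_weight_def left_height_def prod.atMost_shift)
qed

text \<open>Heights are letters plus one: 0 is the outside, 1 the letter 0, and 2 the letter
  1.\<close>

lemma line_weight_values:
  "line_weight (degree_weight a b c) 0 (Suc 0) = a ^ 2"
  "line_weight (degree_weight a b c) 0 2 = a ^ 2 * b"
  "line_weight (degree_weight a b c) (Suc 0) 0 = a ^ 2"
  "line_weight (degree_weight a b c) 2 0 = a ^ 2 * b"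
  "line_weight (degree_weight a b c) (Suc 0) (Suc 0) = b ^ 2"
  "line_weight (degree_weight a b c) (Suc 0) 2 = a * b * c"
  "line_weight (degree_weight a b c) 2 (Suc 0) = a * b * c"
  "line_weight (degree_weight a b c) 2 2 = b ^ 2 * c"
  by (simp_all add: line_weight_def line_degree_def degree_weight_def eval_nat_numeral)

section \<open>Decomposition of the admissible words by their first letter\<close>

lemma finite_fib_words: "finite (fib_words n k)"
  by (rule finite_subset[OF _ finite_lists_length_eq[of "{0, 1}" n]]) (auto simp: fib_words_def)

text \<open>A run of length \<open>k\<close> starting among the \<open>j < k\<close> leading letters
  would have to reach into \<open>v\<close>, forcing \<open>v\<close> to begin with
  \<open>x\<close>.\<close>

lemma not_sublist_replicate_append:
  assumes "\<not> sublist (replicate k x) v" "v = [] \<or> hd v \<noteq> x" "j < k"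
  shows "\<not> sublist (replicate k x) (replicate j x @ v)"
  using assms(3)
proof (induction j)
  case 0
  then show ?case using assms(1) by simp
next
  case (Suc j)
  have "\<not> prefix (replicate k x) (replicate (Suc j) x @ v)"
  proof
    assume "prefix (replicate k x) (replicate (Suc j) x @ v)"
    moreover from Suc.prems obtain d where "k = Suc j + Suc d"
      by (metis add_Suc_right less_imp_Suc_add)
    ultimately have "prefix (replicate (Suc d) x) v"
      by (metis replicate_add same_prefix_prefix)
    with assms(2) show False by (cases v) auto
  qed
  with Suc show ?case by (simp add: sublist_Cons_right)
qed

definition fib_words_from :: "nat \<Rightarrow> nat \<Rightarrow> nat \<Rightarrow> nat list set" where
  "fib_words_from a n k = {w \<in> fib_words n k. w \<noteq> [] \<and> hd w = a}"

lemma fib_words_from_0 [simp]: "fib_words_from a 0 k = {}"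
  by (auto simp: fib_words_from_def fib_words_def)

lemma finite_fib_words_from: "finite (fib_words_from a n k)"
  by (simp add: fib_words_from_def finite_fib_words)

lemma fib_words_from_zero_Suc:
  assumes "0 < k"
  shows "fib_words_from 0 (Suc n) k = Cons 0 ` fib_words n k"
proof -
  have "\<not> prefix (replicate k 1) (0 # w)" for w :: "nat list"
    using assms by (cases k) auto
  then show ?thesis
    by (auto simp: fib_words_from_def fib_words_def sublist_Cons_right length_Suc_conv image_iff)
qed

text \<open>For \<open>k = 0\<close> the empty run occurs in every word, so even \<open>[]\<close>
  is inadmissible.\<close>

lemma fib_words_split:
  "fib_words n k = (if n = 0 \<and> 0 < k then {[]} else {}) \<union> fib_words_from 0 n k \<union> fib_words_from 1 n k"
  by (auto simp: fib_words_from_def fib_words_def neq_Nil_conv)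

text \<open>Prepending a 1 leaves the set of admissible words exactly when the result is \<open>1\<^sup>k v\<close> with \<open>v\<close>
  admissible and not starting with 1.\<close>

lemma fib_words_from_one_Suc:
  assumes "0 < k"
  shows "Cons 1 ` fib_words n k = fib_words_from 1 (Suc n) k \<union>
    (if k \<le> Suc n then append (replicate k 1) ` (fib_words (Suc n - k) k - fib_words_from 1 (Suc n - k) k) else {})"
    (is "?L = ?F \<union> ?B")
   and "fib_words_from 1 (Suc n) k \<inter>
    (if k \<le> Suc n then append (replicate k 1) ` (fib_words (Suc n - k) k - fib_words_from 1 (Suc n - k) k) else {}) = {}"
proof -
  let ?r = "replicate k (1::nat)"
  show "?F \<inter> ?B = {}"
    by (auto simp: fib_words_from_def fib_words_def)
  obtain k' where k: "k = Suc k'" using assms by (cases k) auto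
  show "?L = ?F \<union> ?B"
  proof (intro equalityI subsetI)
    fix u assume "u \<in> ?L"
    then obtain w where u: "u = 1 # w" and w: "w \<in> fib_words n k" by auto
    show "u \<in> ?F \<union> ?B"
    proof (cases "prefix ?r u")
      case False
      then show ?thesis using u w
        by (auto simp: fib_words_from_def fib_words_def sublist_Cons_right)
    next
      case True
      then obtain v where uv: "u = ?r @ v" by (auto simp: prefix_def)
      then have wv: "w = replicate k' 1 @ v" using u k by simp
      have "length w = n" using w by (simp add: fib_words_def)
      then have len: "k \<le> Suc n" "length v = Suc n - k" using wv k by auto
      have "v \<in> fib_words (Suc n - k) k"
        using w len wv by (auto simp: fib_words_def sublist_append)
      moreover have "v \<notin> fib_words_from 1 (Suc n - k) k"
      proof
        assume "v \<in> fib_words_from 1 (Suc n - k) k"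
        then obtain v' where "v = 1 # v'" by (auto simp: fib_words_from_def neq_Nil_conv)
        \<comment> \<open>The \<open>k - 1\<close> ones before \<open>v\<close> and the first letter
          of \<open>v\<close> form a forbidden run inside \<open>w\<close>.\<close>
        then have "w = ?r @ v'" using wv k by (simp add: replicate_app_Cons_same)
        then have "sublist ?r w" by simp
        with w show False by (simp add: fib_words_def)
      qed
      ultimately show ?thesis using uv len by auto
    qed
  next
    fix u assume "u \<in> ?F \<union> ?B"
    then show "u \<in> ?L"
    proof
      assume "u \<in> ?F"
      then show ?thesis
        by (auto simp: fib_words_from_def fib_words_def sublist_Cons_right length_Suc_conv image_iff)
    next
      assume "u \<in> ?B"
      then obtain v where kn: "k \<le> Suc n" and u: "u = ?r @ v" and v: "v \<in> fib_words (Suc n - k) k"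
        "v \<notin> fib_words_from 1 (Suc n - k) k" by (auto split: if_splits)
      then have "v = [] \<or> hd v \<noteq> 1" by (auto simp: fib_words_from_def)
      then have "\<not> sublist ?r (replicate k' 1 @ v)"
        using not_sublist_replicate_append[of k 1 v k'] v k by (auto simp: fib_words_def)
      then have "replicate k' 1 @ v \<in> fib_words n k"
        using v kn k by (auto simp: fib_words_def)
      then show ?thesis using u k by auto
    qed
  qed
qed

section \<open>Generating functions and their linear system\<close>

lemma column_height_fib_words_from: "w \<in> fib_words_from a n k \<Longrightarrow> column_height w 0 = Suc a"
  by (cases w) (auto simp: fib_words_from_def)

text \<open>Serves both the sum over all admissible words and the correction for words that acquire
  a run of length \<open>k\<close>.\<close>

lemma sum_chain_weight_Cons_not_one:
  assumes "0 < k"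
  shows "(\<Sum>w\<in>fib_words n k - fib_words_from 1 n k. chain_weight f (a # w)) =
    (if n = 0 then line_weight f (Suc a) 0 else 0)
    + line_weight f (Suc a) 1 * (\<Sum>w\<in>fib_words_from 0 n k. chain_weight f w)"
proof -
  have "fib_words n k - fib_words_from 1 n k = (if n = 0 then {[]} else {}) \<union> fib_words_from 0 n k"
  proof -
    have "fib_words_from 0 n k \<inter> fib_words_from 1 n k = {}" "[] \<notin> fib_words_from 1 n k"
      by (auto simp: fib_words_from_def)
    then show ?thesis
      unfolding fib_words_split[of n k] using assms by auto
  qed
  then have "(\<Sum>w\<in>fib_words n k - fib_words_from 1 n k. chain_weight f (a # w)) =
    (if n = 0 then chain_weight f [a] else 0)
    + (\<Sum>w\<in>fib_words_from 0 n k. chain_weight f (a # w))"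
    by (cases "n = 0") simp_all
  then show ?thesis
    by (simp add: chain_weight_Cons sum_distrib_left column_height_fib_words_from cong: sum.cong)
qed

lemma sum_chain_weight_Cons:
  assumes "0 < k"
  shows "(\<Sum>w\<in>fib_words n k. chain_weight f (a # w)) =
    (if n = 0 then line_weight f (Suc a) 0 else 0)
    + line_weight f (Suc a) 1 * (\<Sum>w\<in>fib_words_from 0 n k. chain_weight f w)
    + line_weight f (Suc a) 2 * (\<Sum>w\<in>fib_words_from 1 n k. chain_weight f w)"
proof -
  have "fib_words_from 1 n k \<subseteq> fib_words n k" by (auto simp: fib_words_from_def)
  from sum.subset_diff[OF this finite_fib_words, of "\<lambda>w. chain_weight f (a # w)"]
  show ?thesis
    unfolding sum_chain_weight_Cons_not_one[OF assms]
    by (simp add: chain_weight_Cons sum_distrib_left column_height_fib_words_from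
        numeral_2_eq_2 cong: sum.cong)
qed

text \<open>\<open>Suc m\<close> equal letters have only \<open>m\<close> lines between them; this
  yields the exponent \<open>k - 1\<close> of the correction term.\<close>

lemma chain_weight_replicate_append:
  "chain_weight f (replicate (Suc m) a @ v) =
     line_weight f (Suc a) (Suc a) ^ m * chain_weight f (a # v)"
  by (induction m) (simp_all add: chain_weight_Cons mult.assoc)

definition fib_fps :: "(nat \<Rightarrow> 'a::comm_ring_1) \<Rightarrow> nat \<Rightarrow> nat \<Rightarrow> 'a fps" where
  "fib_fps f a k = Abs_fps (\<lambda>n. \<Sum>w\<in>fib_words_from a n k. chain_weight f w)"

lemma fib_fps_zero_eq:
  assumes "0 < k"
  shows "fib_fps f 0 k = fps_X * (fps_const (line_weight f 1 0)
    + fps_const (line_weight f 1 1) * fib_fps f 0 k + fps_const (line_weight f 1 2) * fib_fps f 1 k)"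
proof (rule fps_ext)
  fix n
  show "fib_fps f 0 k $ n = (fps_X * (fps_const (line_weight f 1 0)
    + fps_const (line_weight f 1 1) * fib_fps f 0 k
    + fps_const (line_weight f 1 2) * fib_fps f 1 k)) $ n"
  proof (cases n)
    case 0
    then show ?thesis by (simp add: fib_fps_def)
  next
    case (Suc m)
    have "fib_fps f 0 k $ n = (\<Sum>w\<in>fib_words m k. chain_weight f (0 # w))"
      by (simp add: fib_fps_def Suc fib_words_from_zero_Suc[OF assms] sum.reindex)
    then show ?thesis
      by (simp add: sum_chain_weight_Cons[OF assms] Suc fib_fps_def)
  qed
qed

text \<open>Prepending 1 to all admissible words gives the right-hand side. The second summand on
  the left accounts for the inadmissible results \<open>1^k v\<close>, with \<open>v\<close> empty
  or starting with 0.\<close>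

lemma fib_fps_one_eq:
  fixes f :: "nat \<Rightarrow> 'a::comm_ring_1"
  assumes "0 < k"
  shows "fib_fps f 1 k + fps_const (line_weight f 2 2 ^ (k - 1)) * (fps_X ^ k *
      (fps_const (line_weight f 2 0) + fps_const (line_weight f 2 1) * fib_fps f 0 k)) =
    fps_X * (fps_const (line_weight f 2 0)
      + fps_const (line_weight f 2 1) * fib_fps f 0 k + fps_const (line_weight f 2 2) * fib_fps f 1 k)"
    (is "?L = ?R")
proof (rule fps_ext)
  fix n
  show "?L $ n = ?R $ n"
  proof (cases n)
    case 0
    then show ?thesis using assms by (simp add: fib_fps_def)
  next
    case (Suc m)
    let ?r = "replicate k (1::nat)"
    let ?W = "fib_words (n - k) k - fib_words_from 1 (n - k) k"
    have chain: "chain_weight f (?r @ v) = line_weight f 2 2 ^ (k - 1) * chain_weight f (1 # v)" for v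
      using chain_weight_replicate_append[of f "k - 1" 1 v] assms by (simp add: numeral_2_eq_2)
    have "?R $ n = (\<Sum>w\<in>fib_words m k. chain_weight f (1 # w))"
      by (simp add: sum_chain_weight_Cons[OF assms] Suc fib_fps_def numeral_2_eq_2)
    also have "\<dots> = sum (chain_weight f) (Cons 1 ` fib_words m k)"
      by (simp add: sum.reindex)
    also have "\<dots> = sum (chain_weight f) (fib_words_from 1 n k)
        + sum (chain_weight f) (if k \<le> n then append ?r ` ?W else {})"
      unfolding fib_words_from_one_Suc(1)[OF assms] Suc
      by (rule sum.union_disjoint)
        (use fib_words_from_one_Suc(2)[OF assms] in
          \<open>auto simp: finite_fib_words_from finite_fib_words\<close>)
    also have "sum (chain_weight f) (if k \<le> n then append ?r ` ?W else {}) =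
        (if k \<le> n then line_weight f 2 2 ^ (k - 1) * (\<Sum>v\<in>?W. chain_weight f (1 # v)) else 0)"
      by (simp add: sum.reindex inj_on_def chain sum_distrib_left del: One_nat_def)
    \<comment> \<open>Multiplication by \<open>fps_X ^ k\<close> shifts the index to
      \<open>n - k\<close> and gives 0 for \<open>n < k\<close>, matching the conditional.\<close>
    also have "sum (chain_weight f) (fib_words_from 1 n k) + \<dots> = ?L $ n"
      by (simp add: sum_chain_weight_Cons_not_one[OF assms] fps_X_power_mult_nth fib_fps_def
          del: One_nat_def)
    finally show ?thesis by simp
  qed
qed

section \<open>Solving the system for \<open>D k\<close>\<close>

lemma D_eq_fib_fps:
  "D k = fps_const (q2 ^ 2) * fib_fps (degree_weight q2 q3 q4) 0 k
     + fps_const (q2 ^ 2 * q3) * fib_fps (degree_weight q2 q3 q4) 1 k"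
proof (rule fps_ext)
  fix n
  let ?f = "degree_weight q2 q3 q4"
  let ?m = "\<lambda>w. q2 ^ num_deg 2 (bargraph_graph w) * q3 ^ num_deg 3 (bargraph_graph w)
    * q4 ^ num_deg 4 (bargraph_graph w)"
  have *: "sum ?m (fib_words_from a n k) = line_weight ?f 0 (Suc a) * fib_fps ?f a k $ n" for a
    unfolding fib_fps_def fps_nth_Abs_fps sum_distrib_left
  proof (intro sum.cong refl)
    fix w assume w: "w \<in> fib_words_from a n k"
    then have "w \<noteq> []" by (simp add: fib_words_from_def)
    from degree_monomial_eq[OF this, of q2 q3 q4] show "?m w = line_weight ?f 0 (Suc a) * chain_weight ?f w"
      by (simp add: column_height_fib_words_from[OF w])
  qed
  show "D k $ n = (fps_const (q2 ^ 2) * fib_fps ?f 0 k + fps_const (q2 ^ 2 * q3) * fib_fps ?f 1 k) $ n"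
  proof (cases "n = 0")
    case True
    then show ?thesis by (simp add: D_def fib_fps_def)
  next
    case False
    then have "fib_words n k = fib_words_from 0 n k \<union> fib_words_from 1 n k"
      using fib_words_split[of n k] by simp
    then have "sum ?m (fib_words n k) = sum ?m (fib_words_from 0 n k) + sum ?m (fib_words_from 1 n k)"
      by (simp only:) (rule sum.union_disjoint,
        auto simp: finite_fib_words_from, auto simp: fib_words_from_def)
    then show ?thesis using False
      unfolding * by (simp add: D_def line_weight_values flip: numeral_2_eq_2)
  qed
qed

text \<open>Cramer's rule for two linear equations in \<open>z\<close> and \<open>y\<close>; it is applied with
  \<open>u = (b\<^sup>2 c x) ^ (k - 1)\<close>.\<close>

lemma transfer_system_solution:
  fixes a b c x u y z :: "'a::comm_ring_1"
  assumes z: "z = x * (a^2 + b^2 * z + a * b * c * y)"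
    and y: "y + u * x * (a^2 * b + a * b * c * z) = x * (a^2 * b + a * b * c * z + b^2 * c * y)"
  shows "c * (1 - (b^2 + c * b^2) * x + (c * b^4 - a^2 * c^2 * b^2) * x^2 + a^2 * c^2 * b^2 * u * x^2)
      * (a^2 * z + a^2 * b * y) =
    a^4 * ((b^2 * c + c) * x - (b^2 * c^2 - 2 * a * b^2 * c^2 + b^4 * c) * x^2
      - b^2 * c * u * x + (b^4 * c * u - 2 * a * b^2 * c^2 * u) * x^2)" (is "?L = ?R")
proof -
  define e1 where "e1 = z - x * (a^2 + b^2 * z + a * b * c * y)"
  define e2 where "e2 = y + u * x * (a^2 * b + a * b * c * z)
    - x * (a^2 * b + a * b * c * z + b^2 * c * y)"
  \<comment> \<open>The multipliers of \<open>e1\<close> and \<open>e2\<close> are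
    \<open>c * a^2\<close> times the row \<open>(1, b)\<close> times the adjugate of the coefficient
    matrix, whose determinant is the bracket after \<open>c\<close> in \<open>?L\<close>.\<close>
  have "?L - ?R = c * a^2 * (1 - b^2 * c * x + a * b^2 * c * x * (1 - u)) * e1
      + c * a^2 * (a * b * c * x + b * (1 - b^2 * x)) * e2"
    unfolding e1_def e2_def
    by (simp add: algebra_simps power2_eq_square power4_eq_xxxx)
  also have "\<dots> = 0"
    using z y by (simp add: e1_def e2_def)
  finally show ?thesis by simp
qed

lemma q4_nonzero: "q4 \<noteq> 0"
  by (simp add: q4_def Zero_fract_def eq_fract)

theorem theorem3p1:
  fixes k :: nat
  assumes "k \<ge> 2"
  shows "D k =
    (let x = fps_X; q\<^sub>2 = fps_const q2; q\<^sub>3 = fps_const q3; q\<^sub>4 = fps_const q4 in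
      (q\<^sub>2^4 * ((q\<^sub>3^2 * q\<^sub>4 + q\<^sub>4) * x
          - (q\<^sub>3^2 * q\<^sub>4^2 - 2 * q\<^sub>2 * q\<^sub>3^2 * q\<^sub>4^2 + q\<^sub>3^4 * q\<^sub>4) * x^2
          - q\<^sub>3^(2*k) * q\<^sub>4^k * x^k
          + (q\<^sub>3^(2*k+2) * q\<^sub>4^k - 2 * q\<^sub>2 * q\<^sub>3^(2*k) * q\<^sub>4^(k+1)) * x^(k+1)))
      / (q\<^sub>4 * (1 - (q\<^sub>3^2 + q\<^sub>4 * q\<^sub>3^2) * x
          + (q\<^sub>4 * q\<^sub>3^4 - q\<^sub>2^2 * q\<^sub>4^2 * q\<^sub>3^2) * x^2
          + q\<^sub>2^2 * q\<^sub>4^(k+1) * q\<^sub>3^(2*k) * x^(k+1))))"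
proof -
  let ?f = "degree_weight q2 q3 q4"
  define x :: "ratfun3 fps" where "x = fps_X"
  define a where "a = fps_const q2"
  define b where "b = fps_const q3"
  define c where "c = fps_const q4"
  define u where "u = (b^2 * c * x) ^ (k - 1)"
  obtain m where k: "k = Suc m" using assms by (cases k) auto
  have z: "fib_fps ?f 0 k = x * (a^2 + b^2 * fib_fps ?f 0 k + a * b * c * fib_fps ?f 1 k)"
    using fib_fps_zero_eq[of k ?f] assms
    by (simp add: line_weight_values x_def a_def b_def c_def)
  have o: "fib_fps ?f 1 k + u * x * (a^2 * b + a * b * c * fib_fps ?f 0 k) =
      x * (a^2 * b + a * b * c * fib_fps ?f 0 k + b^2 * c * fib_fps ?f 1 k)"
    using fib_fps_one_eq[of k ?f] assms
    by (simp add: line_weight_values x_def a_def b_def c_def u_def k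
        power_mult_distrib mult_ac flip: fps_const_mult)
  let ?den = "c * (1 - (b^2 + c * b^2) * x + (c * b^4 - a^2 * c^2 * b^2) * x^2
      + a^2 * c^(k+1) * b^(2*k) * x^(k+1))"
  let ?num = "a^4 * ((b^2 * c + c) * x - (b^2 * c^2 - 2 * a * b^2 * c^2 + b^4 * c) * x^2
      - b^(2*k) * c^k * x^k + (b^(2*k+2) * c^k - 2 * a * b^(2*k) * c^(k+1)) * x^(k+1))"
  \<comment> \<open>Powers with exponents depending on \<open>k\<close> enter only through
    \<open>(b^2 * c * x)^k\<close>; writing it with \<open>u\<close> reduces the claim to a
    polynomial identity.\<close>
  have u: "b^(2*k) * c^k * x^k = b^2 * c * u * x"
    by (simp add: u_def k power_mult_distrib power_mult power2_eq_square mult_ac)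
  have "a^2 * c^(k+1) * b^(2*k) * x^(k+1) = a^2 * c * x * (b^(2*k) * c^k * x^k)"
    by (simp add: mult_ac)
  also have "\<dots> = a^2 * c^2 * b^2 * u * x^2"
    unfolding u by algebra
  finally have den: "?den = c * (1 - (b^2 + c * b^2) * x + (c * b^4 - a^2 * c^2 * b^2) * x^2
      + a^2 * c^2 * b^2 * u * x^2)" by simp
  have "(b^(2*k+2) * c^k - 2 * a * b^(2*k) * c^(k+1)) * x^(k+1) =
      (b^2 * x - 2 * a * c * x) * (b^(2*k) * c^k * x^k)"
    by (simp add: algebra_simps power_add power2_eq_square)
  also have "\<dots> = (b^4 * c * u - 2 * a * b^2 * c^2 * u) * x^2"
    unfolding u by algebra
  finally have num: "?num = a^4 * ((b^2 * c + c) * x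
      - (b^2 * c^2 - 2 * a * b^2 * c^2 + b^4 * c) * x^2
      - b^2 * c * u * x + (b^4 * c * u - 2 * a * b^2 * c^2 * u) * x^2)"
    unfolding u by simp
  have D: "D k = a^2 * fib_fps ?f 0 k + a^2 * b * fib_fps ?f 1 k"
    by (simp add: D_eq_fib_fps a_def b_def)
  have "?den * D k = ?num"
    unfolding den num D by (rule transfer_system_solution[OF z o])
  \<comment> \<open>A nonzero constant coefficient makes the denominator nonzero, so dividing the
    product by it recovers \<open>D k\<close>.\<close>
  moreover have "?den $ 0 = q4"
    by (simp add: x_def c_def)
  then have "?den \<noteq> 0" using q4_nonzero by (metis fps_zero_nth)
  ultimately have "D k = ?num / ?den"
    by (metis nonzero_mult_div_cancel_left)
  then show ?thesis
    by (simp only: Let_def a_def b_def c_def x_def)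
qed

end
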